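(* Let $R$ be a commutative additively idempotent semiring, let $n\ge 2$, and let $A=(a_{ij})\in M_n(R)$. If $a_{ii}\ge a_{jk}$ for all $i,j,k\in\{1,\dots,n\}$, then (1) $\operatorname{adj}(A)=A^{n-1}$; (2) $\operatorname{per}(\operatorname{adj}(A))=(\operatorname{per}(A))^{n-1}$.
   Context: A semiring $(R,+,\cdot)$ consists of a commutative monoid $(R,+)$ with identity $0$ and a monoid $(R,\cdot)$ with identity $1\neq 0$, such that multiplication distributes over addition on both sides and $0\cdot a=a\cdot 0=0$ for all $a\in R$. It is commutative if $ab=ba$ for all $a,b\in R$, and additively idempotent if $a+a=a$ for all $a\in R$. In an additively idempotent semiring, $a\le b$ (equivalently $b\ge a$) means $a+b=b$. $M_n(R)$ is the set of $n\times n$ matrices over $R$, with the usual matrix operations. For $A=(a_{ij})\in M_n(R)$, $\operatorname{per}(A)=\sum_{\sigma\in S_n}a_{1\sigma(1)}a_{2\sigma(2)}\cdots a_{n\sigma(n)}$, where $S_n$ is the symmetric group on $\{1,\dots,n\}$. The adjoint matrix $\operatorname{adj}(A)$ is the $n\times n$ matrix whose $(i,j)$ entry is $\operatorname{per}(A(j|i))$, where $A(j|i)\in M_{n-1}(R)$ is obtained from $A$ by deleting row $j$ and column $i$. *)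

theory Defs
  imports "Jordan_Normal_Form.Determinant"
begin

class add_idem_comm_semiring_1 = comm_semiring_1 +
  assumes add_idem: "a + a = a"

definition sr_le :: "'a :: add_idem_comm_semiring_1 \<Rightarrow> 'a \<Rightarrow> bool" (infix \<open>\<preceq>\<close> 50) where
  "a \<preceq> b \<longleftrightarrow> a + b = b"

(* As for det, rows and columns are numbered from 0 and the value on a
   non-square matrix is 0 by convention. *)
definition per :: "'a :: comm_semiring_1 mat \<Rightarrow> 'a" where
  "per A = (if dim_row A = dim_col A then
     (\<Sum>p \<in> {p. p permutes {0..<dim_row A}}. \<Prod>i = 0..<dim_row A. A $$ (i, p i)) else 0)"

(* The sign-free analogue of adj_mat. mat_delete A j i removes row j and
   column i, so the indices are transposed on purpose. *)
definition per_adj :: "'a :: comm_semiring_1 mat \<Rightarrow> 'a mat" where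
  "per_adj A = mat (dim_row A) (dim_col A) (\<lambda>(i, j). per (mat_delete A j i))"

end

theory Submission
  imports Defs
begin

text \<open>
  Comparing diagonal entries with each other shows that the diagonal of \<open>A\<close> is constant, say equal
  to \<open>d\<close>, and that \<open>d\<close> dominates every entry. In an additively idempotent semiring a finite sum is the
  supremum of its terms, so each identity reduces to comparing individual products of entries.

  The \<open>(i, j)\<close> entry of the adjoint is the supremum, over the permutations \<open>p\<close> with \<open>p j = i\<close>, of the
  products of \<open>A $$ (k, p k)\<close> over \<open>k \<noteq> j\<close>. With the factor at \<open>j\<close> left out, the cycle of \<open>p\<close>
  through \<open>j\<close> becomes a path from \<open>i\<close> to \<open>j\<close>, and the other cycles remain. The \<open>(i, j)\<close> entry of
  \<open>A ^\<^sub>m (n - 1)\<close> is the supremum of the weights of the walks with \<open>n - 1\<close> steps from \<open>i\<close> to \<open>j\<close>.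
  The two suprema agree:

  \<^item> The factors on the other cycles are at most \<open>d\<close>, so they can be traded for loops at a vertex of
    the path, which turns the permutation into a walk of the right length
    (\<open>permutation_prod_le_pow_mat\<close>).

  \<^item> Erasing the cycles of a walk leaves a path, and each erased step has weight at most \<open>d\<close>. The path
    closes up to a cyclic permutation, and its fixed points outside the path contribute one factor
    \<open>d\<close> for each erased step (\<open>walk_weight_le_permutation_prod\<close>).

  For the permanents, the identity permutation attains the largest possible product, so the permanent
  of an \<open>n \<times> n\<close> matrix with a dominant constant diagonal is the \<open>n\<close>-th power of the diagonal entry.
  The adjoint is again such a matrix, with diagonal \<open>d ^ (n - 1)\<close>, and both sides of the second
  identity equal \<open>d ^ (n * (n - 1))\<close>.
\<close>

section \<open>The order of an additively idempotent semiring\<close>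

lemma sr_le_refl [simp]: "a \<preceq> a"
  by (simp add: sr_le_def add_idem)

lemma sr_le_trans [trans]: "a \<preceq> b \<Longrightarrow> b \<preceq> c \<Longrightarrow> a \<preceq> c"
  unfolding sr_le_def by (metis add.assoc)

lemma sr_le_antisym: "a \<preceq> b \<Longrightarrow> b \<preceq> a \<Longrightarrow> a = b"
  unfolding sr_le_def by (metis add.commute)

lemma sr_le_mult_left: "a \<preceq> b \<Longrightarrow> c * a \<preceq> c * b"
  unfolding sr_le_def by (metis distrib_left)

lemma sr_le_mult_mono: "a \<preceq> b \<Longrightarrow> c \<preceq> d \<Longrightarrow> a * c \<preceq> b * d"
  by (metis sr_le_mult_left sr_le_trans mult.commute)

text \<open>
  The next two lemmas say that a finite sum is the least upper bound of its terms. The first rests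
  on idempotence: adding a term a second time does not change the sum.
\<close>
lemma sr_le_sum_upper:
  assumes "finite S" "x \<in> S"
  shows "f x \<preceq> sum f S"
proof -
  have "f x + sum f S = (f x + f x) + sum f (S - {x})"
    by (simp only: sum.remove[OF assms] add.assoc)
  then show ?thesis
    by (simp add: sr_le_def add_idem sum.remove[OF assms])
qed

lemma sr_sum_le:
  assumes "\<And>x. x \<in> S \<Longrightarrow> f x \<preceq> b"
  shows "sum f S \<preceq> b"
  using assms
  by (induction S rule: infinite_finite_induct) (auto simp: sr_le_def add.assoc)

lemma sr_prod_le_power:
  assumes "\<And>x. x \<in> S \<Longrightarrow> f x \<preceq> b"
  shows "prod f S \<preceq> b ^ card S"
  using assms
  by (induction S rule: infinite_finite_induct) (auto intro: sr_le_mult_mono)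

section \<open>Permanents of matrices with a dominant constant diagonal\<close>

text \<open>
  No permutation product exceeds \<open>d ^ n\<close>, and the identity permutation attains it.
\<close>
lemma per_dominant_diagonal:
  fixes B :: "'a :: add_idem_comm_semiring_1 mat"
  assumes B: "B \<in> carrier_mat n n"
    and diag: "\<And>i. i < n \<Longrightarrow> B $$ (i, i) = d"
    and dom: "\<And>i j. i < n \<Longrightarrow> j < n \<Longrightarrow> B $$ (i, j) \<preceq> d"
  shows "per B = d ^ n"
proof (rule sr_le_antisym)
  have per: "per B = (\<Sum>p | p permutes {0..<n}. \<Prod>i = 0..<n. B $$ (i, p i))"
    using B by (simp add: per_def)
  show "per B \<preceq> d ^ n"
    unfolding per
  proof (rule sr_sum_le)
    fix p assume "p \<in> {p. p permutes {0..<n}}"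
    then have "p i < n" if "i < n" for i
      using that permutes_in_image[of p "{0..<n}" i] by simp
    then show "(\<Prod>i = 0..<n. B $$ (i, p i)) \<preceq> d ^ n"
      using sr_prod_le_power[of "{0..<n}" "\<lambda>i. B $$ (i, p i)" d] dom by simp
  qed
  have "(\<Prod>i = 0..<n. B $$ (i, id i)) \<preceq> per B"
    unfolding per
    by (rule sr_le_sum_upper[where f = "\<lambda>p. \<Prod>i = 0..<n. B $$ (i, p i)"])
       (simp_all add: finite_permutations permutes_id del: id_apply)
  then show "d ^ n \<preceq> per B"
    by (simp add: diag)
qed

section \<open>The adjoint as a sum over permutations\<close>

text \<open>
  Deleting row \<open>i\<close> and column \<open>j\<close> has the effect of forcing \<open>p i = j\<close> and omitting that factor;
  this is the sign-free core of Laplace expansion. It avoids index shifts in everything that follows.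
\<close>
lemma per_mat_delete:
  fixes A :: "'a :: comm_semiring_1 mat"
  assumes A: "A \<in> carrier_mat (Suc m) (Suc m)"
    and i: "i < Suc m" and j: "j < Suc m"
  shows "per (mat_delete A i j) =
    (\<Sum>p | p permutes {0..<Suc m} \<and> p i = j. \<Prod>k\<in>{0..<Suc m} - {i}. A $$ (k, p k))"
    (is "_ = sum ?f _")
proof -
  have expand: "?f (permutation_insert i j q) = (\<Prod>k = 0..<m. mat_delete A i j $$ (k, q k))"
    if q: "q permutes {0..<m}" for q
  proof -
    have "?f (permutation_insert i j q) =
        (\<Prod>k = 0..<m. A $$ (insert_index i k, permutation_insert i j q (insert_index i k)))"
      using i by (subst insert_index_image[symmetric, OF i])
                 (simp add: prod.reindex insert_index_inj_on)
    also have "\<dots> = (\<Prod>k = 0..<m. mat_delete A i j $$ (k, q k))"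
    proof (rule prod.cong[OF refl])
      fix k assume k: "k \<in> {0..<m}"
      then have "q k < m"
        using q permutes_in_image[of q "{0..<m}" k] by simp
      moreover have "permutation_insert i j q (insert_index i k) = insert_index j (q k)"
        unfolding permutation_insert_expand insert_index_def by auto
      ultimately show "A $$ (insert_index i k, permutation_insert i j q (insert_index i k)) =
          mat_delete A i j $$ (k, q k)"
        using mat_delete_index[OF A i j] k by simp
    qed
    finally show ?thesis .
  qed
  have "per (mat_delete A i j) =
      (\<Sum>q | q permutes {0..<m}. \<Prod>k = 0..<m. mat_delete A i j $$ (k, q k))"
    using A by (simp add: per_def)
  also have "\<dots> = (\<Sum>q | q permutes {0..<m}. ?f (permutation_insert i j q))"
    by (rule sum.cong) (simp_all add: expand)
  also have "\<dots> = sum ?f (permutation_insert i j ` {q. q permutes {0..<m}})"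
    by (simp add: sum.reindex[OF permutation_insert_inj_on[OF i j]])
  finally show ?thesis
    using permutation_fix[OF i j] by simp
qed

lemma per_adj_entry:
  fixes A :: "'a :: comm_semiring_1 mat"
  assumes A: "A \<in> carrier_mat (Suc m) (Suc m)" and i: "i < Suc m" and j: "j < Suc m"
  shows "per_adj A $$ (i, j) =
    (\<Sum>p | p permutes {0..<Suc m} \<and> p j = i. \<Prod>k\<in>{0..<Suc m} - {j}. A $$ (k, p k))"
  unfolding per_mat_delete[OF A j i, symmetric] using A i j by (simp add: per_adj_def)

section \<open>Powers of matrices and weights of walks\<close>

lemma pow_mat_Suc_left:
  assumes A: "A \<in> carrier_mat n n"
  shows "A ^\<^sub>m Suc m = A * A ^\<^sub>m m"
proof (induction m)
  case 0
  then show ?case using A by simp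
next
  case (Suc m)
  have "A ^\<^sub>m Suc (Suc m) = (A * A ^\<^sub>m m) * A"
    using Suc by simp
  also have "\<dots> = A * (A ^\<^sub>m m * A)"
    using A by (intro assoc_mult_mat[of _ n n _ n _ n]) auto
  finally show ?case by simp
qed

lemma pow_mat_Suc_entry:
  assumes A: "A \<in> carrier_mat n n" and "i < n" "j < n"
  shows "(A ^\<^sub>m Suc m) $$ (i, j) = (\<Sum>k = 0..<n. A $$ (i, k) * (A ^\<^sub>m m) $$ (k, j))"
  unfolding pow_mat_Suc_left[OF A] using assms by (simp add: scalar_prod_def)

text \<open>
  A walk is the list of its vertices, so \<open>length xs - 1\<close> is its number of steps. The empty list has
  weight \<open>1\<close> only to make the function total.
\<close>
fun walk_weight :: "('v \<Rightarrow> 'v \<Rightarrow> 'a) \<Rightarrow> 'v list \<Rightarrow> 'a :: comm_semiring_1" where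
  "walk_weight w (u # v # vs) = w u v * walk_weight w (v # vs)"
| "walk_weight w _ = 1"

text \<open>
  An entry of a matrix power is the supremum of the weights of walks. The factor \<open>c\<close> is there for the induction: it accumulates the steps already
  taken, since a bound on \<open>c * x\<close> gives none on \<open>x\<close> when \<open>c\<close> cannot be cancelled.
\<close>
lemma mult_pow_mat_le_if_walks_le:
  fixes A :: "'a :: add_idem_comm_semiring_1 mat"
  assumes A: "A \<in> carrier_mat n n" and "i < n" "j < n"
    and "\<And>xs. length xs = Suc m \<Longrightarrow> set xs \<subseteq> {0..<n} \<Longrightarrow> hd xs = i \<Longrightarrow> last xs = j \<Longrightarrow>
           c * walk_weight (\<lambda>u v. A $$ (u, v)) xs \<preceq> b"
  shows "c * (A ^\<^sub>m m) $$ (i, j) \<preceq> b"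
  using assms(2-)
proof (induction m arbitrary: i c)
  case 0
  show ?case
  proof (cases "i = j")
    case True
    then show ?thesis using 0(1) 0(3)[of "[i]"] A by simp
  next
    case False
    then show ?thesis using 0(1,2) A by (simp add: sr_le_def)
  qed
next
  case (Suc m)
  have "c * A $$ (i, k) * (A ^\<^sub>m m) $$ (k, j) \<preceq> b" if k: "k < n" for k
  proof (rule Suc.IH[OF k Suc.prems(2)])
    fix xs assume xs: "length xs = Suc m" "set xs \<subseteq> {0..<n}" "hd xs = k" "last xs = j"
    then obtain ys where "xs = k # ys" by (cases xs) auto
    then show "c * A $$ (i, k) * walk_weight (\<lambda>u v. A $$ (u, v)) xs \<preceq> b"
      using Suc.prems(3)[of "i # xs"] xs Suc.prems(1) by (simp add: mult.assoc)
  qed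
  then show ?case
    unfolding pow_mat_Suc_entry[OF A Suc.prems(1,2)] sum_distrib_left
    by (intro sr_sum_le) (simp add: mult.assoc)
qed

section \<open>Loop erasure\<close>

lemma walk_weight_append:
  "walk_weight w (as @ u # bs) = walk_weight w (as @ [u]) * walk_weight w (u # bs)"
  by (induction w as rule: walk_weight.induct) (auto simp: mult.assoc neq_Nil_conv)

lemma walk_weight_le_power:
  assumes "\<And>u v. u \<in> set xs \<Longrightarrow> v \<in> set xs \<Longrightarrow> w u v \<preceq> d"
  shows "walk_weight w xs \<preceq> d ^ (length xs - 1)"
  using assms by (induction w xs rule: walk_weight.induct) (auto intro: sr_le_mult_mono)

text \<open>
  The walk is processed from its last vertex backwards, keeping a path \<open>ys\<close> for the part already
  seen. If the new vertex \<open>u\<close> is not on \<open>ys\<close>, it is put in front. Otherwise the step from \<open>u\<close> and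
  the part of \<open>ys\<close> before \<open>u\<close> form a cycle, which is erased at the price of one \<open>d\<close> per step.
\<close>
lemma loop_erasure:
  fixes w :: "'v \<Rightarrow> 'v \<Rightarrow> 'a :: add_idem_comm_semiring_1"
  assumes "xs \<noteq> []" and "\<And>u v. u \<in> set xs \<Longrightarrow> v \<in> set xs \<Longrightarrow> w u v \<preceq> d"
  shows "\<exists>ys. ys \<noteq> [] \<and> distinct ys \<and> set ys \<subseteq> set xs \<and> hd ys = hd xs \<and> last ys = last xs \<and>
    length ys \<le> length xs \<and> walk_weight w xs \<preceq> walk_weight w ys * d ^ (length xs - length ys)"
  using assms
proof (induction w xs rule: walk_weight.induct)
  case (1 w u v vs)
  let ?xs = "v # vs"
  obtain ys where ys: "ys \<noteq> []" "distinct ys" "set ys \<subseteq> set ?xs" "hd ys = v"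
      "last ys = last ?xs" "length ys \<le> length ?xs"
      "walk_weight w ?xs \<preceq> walk_weight w ys * d ^ (length ?xs - length ys)"
    using "1.IH" "1.prems" by auto
  show ?case
  proof (cases "u \<in> set ys")
    case False
    have "walk_weight w (u # ys) = w u v * walk_weight w ys"
      using ys(1,4) by (cases ys) auto
    then have "walk_weight w (u # ?xs) \<preceq>
        walk_weight w (u # ys) * d ^ (length (u # ?xs) - length (u # ys))"
      using sr_le_mult_left[OF ys(7), of "w u v"] by (simp add: mult.assoc)
    then show ?thesis
      using ys False by (intro exI[of _ "u # ys"]) auto
  next
    case True
    then obtain as bs where split: "ys = as @ u # bs"
      by (meson split_list)
    have sub: "set (as @ [u]) \<subseteq> set (u # ?xs)"
      using ys(3) unfolding split by auto
    have "walk_weight w (as @ [u]) \<preceq> d ^ (length (as @ [u]) - 1)"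
      by (rule walk_weight_le_power, rule "1.prems"(2); rule subsetD[OF sub])
    then have "walk_weight w (as @ [u]) \<preceq> d ^ length as" by simp
    then have "walk_weight w ys \<preceq> d ^ length as * walk_weight w (u # bs)"
      unfolding split walk_weight_append[of w as u bs] by (intro sr_le_mult_mono) auto
    then have "walk_weight w ys * d ^ (length ?xs - length ys) \<preceq>
        (d ^ length as * walk_weight w (u # bs)) * d ^ (length ?xs - length ys)"
      by (intro sr_le_mult_mono) auto
    with ys(7) have "walk_weight w ?xs \<preceq>
        (d ^ length as * walk_weight w (u # bs)) * d ^ (length ?xs - length ys)"
      by (rule sr_le_trans)
    then have "w u v * walk_weight w ?xs \<preceq>
        d * ((d ^ length as * walk_weight w (u # bs)) * d ^ (length ?xs - length ys))"
      using "1.prems"(2) by (intro sr_le_mult_mono) auto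
    also have "\<dots> = walk_weight w (u # bs) * d ^ (Suc (length as) + (length ?xs - length ys))"
      by (simp add: power_add ac_simps)
    also have "Suc (length as) + (length ?xs - length ys) = length (u # ?xs) - length (u # bs)"
      using ys(6) by (simp add: split)
    finally have "walk_weight w (u # ?xs) \<preceq>
        walk_weight w (u # bs) * d ^ (length (u # ?xs) - length (u # bs))"
      by simp
    then show ?thesis
      using ys split by (intro exI[of _ "u # bs"]) auto
  qed
next
  case ("2_2" w v)
  then show ?case by (intro exI[of _ "[v]"]) auto
qed simp

section \<open>Paths and permutations\<close>

text \<open>
  The permutation is the cycle that follows the path and returns from its end to its start.
  Putting \<open>u\<close> in front of a path with start \<open>v\<close> amounts to composing with the transposition of \<open>u\<close>
  and \<open>v\<close>: the end of the path, which used to return to \<open>v\<close>, is redirected to \<open>u\<close>, and the fixed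
  point \<open>u\<close> is sent to \<open>v\<close>.
\<close>
lemma path_closes_to_permutation:
  fixes w :: "'v \<Rightarrow> 'v \<Rightarrow> 'a :: comm_semiring_1"
  assumes "distinct xs" "xs \<noteq> []"
  shows "\<exists>p. p permutes set xs \<and> p (last xs) = hd xs \<and>
    (\<Prod>v\<in>set xs - {last xs}. w v (p v)) = walk_weight w xs"
  using assms
proof (induction w xs rule: walk_weight.induct)
  case (1 w u v vs)
  let ?xs = "v # vs"
  let ?l = "last ?xs"
  have u: "u \<notin> set ?xs" using "1.prems" by auto
  obtain p where p: "p permutes set ?xs" "p ?l = v"
      "(\<Prod>k\<in>set ?xs - {?l}. w k (p k)) = walk_weight w ?xs"
    using "1.IH" "1.prems" by auto
  have pu: "p u = u" using p(1) u by (rule permutes_not_in)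
  define q where "q = transpose u v \<circ> p"
  have q_perm: "q permutes set (u # ?xs)"
    unfolding q_def
    by (intro permutes_compose permutes_swap_id permutes_subset[OF p(1)]) auto
  have l: "?l \<in> set ?xs" by (rule last_in_set) simp
  have same: "q k = p k" if "k \<in> set ?xs - {?l}" for k
  proof -
    have "p k \<in> set ?xs" using that permutes_in_image[OF p(1)] by blast
    moreover have "p k \<noteq> v"
      using that p(2) permutes_inj[OF p(1)] by (metis DiffD2 injD singletonI)
    ultimately show ?thesis using u by (auto simp: q_def transpose_def)
  qed
  have "set (u # ?xs) - {?l} = insert u (set ?xs - {?l})"
    using u l by auto
  then have "(\<Prod>k\<in>set (u # ?xs) - {?l}. w k (q k)) =
      w u (q u) * (\<Prod>k\<in>set ?xs - {?l}. w k (q k))"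
    using u by simp
  also have "\<dots> = walk_weight w (u # ?xs)"
    using p(3) same pu by (simp add: q_def)
  finally have "(\<Prod>k\<in>set (u # ?xs) - {?l}. w k (q k)) = walk_weight w (u # ?xs)" .
  moreover have "q ?l = u" using p(2) by (simp add: q_def)
  moreover have "last (u # ?xs) = ?l" "hd (u # ?xs) = u" by simp_all
  ultimately show ?case using q_perm by metis
next
  case ("2_2" w v)
  then show ?case by (intro exI[of _ id]) (auto simp: permutes_id)
qed simp

text \<open>
  The induction follows the cycle through \<open>j\<close> starting at \<open>i = p j\<close>. As long as \<open>i \<noteq> j\<close>, the step
  from \<open>i\<close> to \<open>p i\<close> is split off and \<open>i\<close> is cut out of its cycle, leaving a permutation of
  \<open>S - {i}\<close> that sends \<open>j\<close> to \<open>p i\<close>. Once \<open>i = j\<close>, all remaining factors lie on the other cycles;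
  they are replaced by loops at \<open>j\<close>. Stating this for arbitrary \<open>S\<close> makes both the cut and the count
  of the steps fit the induction.
\<close>
lemma permutation_prod_le_pow_mat:
  fixes A :: "'a :: add_idem_comm_semiring_1 mat"
  assumes A: "A \<in> carrier_mat n n"
    and diag: "\<And>i. i < n \<Longrightarrow> A $$ (i, i) = d"
    and dom: "\<And>i j. i < n \<Longrightarrow> j < n \<Longrightarrow> A $$ (i, j) \<preceq> d"
    and "S \<subseteq> {0..<n}" "p permutes S" "j \<in> S" "p j = i" "card S = Suc m"
  shows "(\<Prod>k\<in>S - {j}. A $$ (k, p k)) \<preceq> (A ^\<^sub>m m) $$ (i, j)"
  using assms(4-)
proof (induction m arbitrary: S p i)
  case 0
  then have "S = {j}" by (auto simp: card_Suc_eq)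
  then show ?case using 0 A by (auto simp: permutes_sing)
next
  case (Suc m)
  have fin: "finite S" using Suc.prems(1) finite_subset by blast
  have jn: "j < n" using Suc.prems by auto
  have iS: "i \<in> S" using Suc.prems permutes_in_image by metis
  then have i_n: "i < n" using Suc.prems by auto
  have step: "A $$ (i, k) * (A ^\<^sub>m m) $$ (k, j) \<preceq> (A ^\<^sub>m Suc m) $$ (i, j)" if "k < n" for k
    unfolding pow_mat_Suc_entry[OF A i_n jn]
    by (rule sr_le_sum_upper[where f = "\<lambda>k. A $$ (i, k) * (A ^\<^sub>m m) $$ (k, j)"])
       (use that in auto)
  show ?case
  proof (cases "i = j")
    case True
    \<comment> \<open>The walk that stays at \<open>j\<close> has weight \<open>d ^ r\<close>.\<close>
    have loops: "d ^ r \<preceq> (A ^\<^sub>m r) $$ (j, j)" for r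
    proof (induction r)
      case 0
      then show ?case using jn A by simp
    next
      case (Suc r)
      have "d * d ^ r \<preceq> A $$ (j, j) * (A ^\<^sub>m r) $$ (j, j)"
        using Suc diag[OF jn] by (simp add: sr_le_mult_left)
      also have "\<dots> \<preceq> (A ^\<^sub>m Suc r) $$ (j, j)"
        unfolding pow_mat_Suc_entry[OF A jn jn]
        by (rule sr_le_sum_upper[where f = "\<lambda>k. A $$ (j, k) * (A ^\<^sub>m r) $$ (k, j)"])
           (use jn in auto)
      finally show ?case by simp
    qed
    have "A $$ (k, p k) \<preceq> d" if "k \<in> S - {j}" for k
      using that Suc.prems(1) permutes_in_image[OF Suc.prems(2), of k] by (intro dom) auto
    then have "(\<Prod>k\<in>S - {j}. A $$ (k, p k)) \<preceq> d ^ card (S - {j})"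
      by (rule sr_prod_le_power)
    also have "card (S - {j}) = Suc m" using Suc.prems fin by simp
    also have "d ^ Suc m \<preceq> (A ^\<^sub>m Suc m) $$ (i, j)"
      unfolding True by (rule loops)
    finally show ?thesis .
  next
    case False
    \<comment> \<open>\<open>q\<close> fixes \<open>i\<close>, sends \<open>j\<close> directly to \<open>p i\<close>, and agrees with \<open>p\<close> elsewhere.\<close>
    define q where "q = transpose i (p i) \<circ> p"
    have piS: "p i \<in> S" using iS permutes_in_image[OF Suc.prems(2)] by blast
    have "q permutes S"
      unfolding q_def using iS piS Suc.prems(2) by (intro permutes_compose permutes_swap_id)
    moreover have "q i = i" by (simp add: q_def)
    ultimately have q: "q permutes S - {i}"
      by (auto intro: permutes_superset)
    have same: "q k = p k" if "k \<in> S - {i} - {j}" for k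
    proof -
      have "p k \<noteq> i" "p k \<noteq> p i"
        using that Suc.prems(4) permutes_inj[OF Suc.prems(2)] by (auto dest: injD)
      then show ?thesis by (simp add: q_def transpose_def)
    qed
    have IH: "(\<Prod>k\<in>S - {i} - {j}. A $$ (k, q k)) \<preceq> (A ^\<^sub>m m) $$ (p i, j)"
    proof (rule Suc.IH[OF _ q])
      show "S - {i} \<subseteq> {0..<n}" "j \<in> S - {i}" "card (S - {i}) = Suc m"
        using Suc.prems False fin iS by auto
      show "q j = p i" using Suc.prems(4) by (simp add: q_def)
    qed
    have "S - {j} = insert i (S - {i} - {j})" using iS False by auto
    then have "(\<Prod>k\<in>S - {j}. A $$ (k, p k)) =
        A $$ (i, p i) * (\<Prod>k\<in>S - {i} - {j}. A $$ (k, p k))"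
      using fin by simp
    also have "\<dots> = A $$ (i, p i) * (\<Prod>k\<in>S - {i} - {j}. A $$ (k, q k))"
      using same by simp
    also have "\<dots> \<preceq> A $$ (i, p i) * (A ^\<^sub>m m) $$ (p i, j)"
      by (rule sr_le_mult_left[OF IH])
    also have "\<dots> \<preceq> (A ^\<^sub>m Suc m) $$ (i, j)"
      by (rule step) (use piS Suc.prems in auto)
    finally show ?thesis .
  qed
qed

text \<open>
  A walk through as many vertices as \<open>V\<close> has, counted with repetition, loses exactly as many steps in
  loop erasure as there are elements of \<open>V\<close> off the resulting path. Fixing these elements pays for the
  lost steps.
\<close>
lemma walk_weight_le_permutation_prod:
  fixes w :: "'v \<Rightarrow> 'v \<Rightarrow> 'a :: add_idem_comm_semiring_1"
  assumes V: "finite V"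
    and diag: "\<And>v. v \<in> V \<Longrightarrow> w v v = d"
    and dom: "\<And>u v. u \<in> V \<Longrightarrow> v \<in> V \<Longrightarrow> w u v \<preceq> d"
    and xs: "set xs \<subseteq> V" "length xs = card V" "xs \<noteq> []"
  shows "\<exists>p. p permutes V \<and> p (last xs) = hd xs \<and>
    walk_weight w xs \<preceq> (\<Prod>v\<in>V - {last xs}. w v (p v))"
proof -
  obtain ys where ys: "ys \<noteq> []" "distinct ys" "set ys \<subseteq> set xs" "hd ys = hd xs"
      "last ys = last xs" "walk_weight w xs \<preceq> walk_weight w ys * d ^ (length xs - length ys)"
    using loop_erasure[OF xs(3), of w d] dom xs(1) by blast
  obtain p where p: "p permutes set ys" "p (last ys) = hd ys"
      "(\<Prod>v\<in>set ys - {last ys}. w v (p v)) = walk_weight w ys"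
    using path_closes_to_permutation[OF ys(2,1)] by blast
  have sub: "set ys \<subseteq> V" using ys(3) xs(1) by blast
  have "(\<Prod>v\<in>V - set ys. w v (p v)) = (\<Prod>v\<in>V - set ys. d)"
    by (rule prod.cong) (auto simp: permutes_not_in[OF p(1)] diag)
  also have "\<dots> = d ^ (length xs - length ys)"
    using V sub ys(2) xs(2) by (simp add: card_Diff_subset distinct_card)
  finally have outside: "(\<Prod>v\<in>V - set ys. w v (p v)) = d ^ (length xs - length ys)" .
  have "V - {last xs} = (set ys - {last ys}) \<union> (V - set ys)"
    using sub ys(1,5) last_in_set[of ys] by auto
  then have "(\<Prod>v\<in>V - {last xs}. w v (p v)) =
      (\<Prod>v\<in>set ys - {last ys}. w v (p v)) * (\<Prod>v\<in>V - set ys. w v (p v))"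
    using V by (simp add: prod.union_disjoint Int_Diff Diff_Int_distrib2 inf.absorb1 disjoint_iff)
  then have "walk_weight w xs \<preceq> (\<Prod>v\<in>V - {last xs}. w v (p v))"
    using ys(6) outside p(3) by simp
  then show ?thesis
    using permutes_subset[OF p(1) sub] p(2) ys(4,5) by metis
qed

section \<open>The adjoint as a power\<close>

lemma per_adj_eq_pow_mat:
  fixes A :: "'a :: add_idem_comm_semiring_1 mat"
  assumes A: "A \<in> carrier_mat (Suc m) (Suc m)"
    and diag: "\<And>i. i < Suc m \<Longrightarrow> A $$ (i, i) = d"
    and dom: "\<And>i j. i < Suc m \<Longrightarrow> j < Suc m \<Longrightarrow> A $$ (i, j) \<preceq> d"
  shows "per_adj A = A ^\<^sub>m m"
proof (rule eq_matI)
  fix i j assume "i < dim_row (A ^\<^sub>m m)" "j < dim_col (A ^\<^sub>m m)"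
  then have i: "i < Suc m" and j: "j < Suc m"
    using pow_mat_dim_square[OF A] by simp_all
  let ?V = "{0..<Suc m}"
  let ?f = "\<lambda>p. \<Prod>k\<in>?V - {j}. A $$ (k, p k)"
  have adj: "per_adj A $$ (i, j) = (\<Sum>p | p permutes ?V \<and> p j = i. ?f p)"
    by (rule per_adj_entry[OF A i j])
  show "per_adj A $$ (i, j) = (A ^\<^sub>m m) $$ (i, j)"
  proof (rule sr_le_antisym)
    show "per_adj A $$ (i, j) \<preceq> (A ^\<^sub>m m) $$ (i, j)"
      unfolding adj
    proof (rule sr_sum_le)
      fix p assume "p \<in> {p. p permutes ?V \<and> p j = i}"
      then show "?f p \<preceq> (A ^\<^sub>m m) $$ (i, j)"
        using j by (intro permutation_prod_le_pow_mat[OF A diag dom]) simp_all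
    qed
    have "1 * (A ^\<^sub>m m) $$ (i, j) \<preceq> per_adj A $$ (i, j)"
    proof (rule mult_pow_mat_le_if_walks_le[OF A i j])
      fix xs assume xs: "length xs = Suc m" "set xs \<subseteq> ?V" "hd xs = i" "last xs = j"
      let ?w = "walk_weight (\<lambda>u v. A $$ (u, v)) xs"
      have "\<exists>p. p permutes ?V \<and> p (last xs) = hd xs \<and>
          ?w \<preceq> (\<Prod>v\<in>?V - {last xs}. A $$ (v, p v))"
        by (rule walk_weight_le_permutation_prod) (use xs diag dom in auto)
      then obtain p where p: "p permutes ?V" "p j = i" "?w \<preceq> ?f p"
        using xs by auto
      have "?f p \<preceq> per_adj A $$ (i, j)"
        unfolding adj by (rule sr_le_sum_upper[where f = ?f]) (use p in \<open>simp_all add: finite_permutations\<close>)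
      with p(3) show "1 * ?w \<preceq> per_adj A $$ (i, j)"
        using sr_le_trans[of ?w "?f p"] by simp
    qed
    then show "(A ^\<^sub>m m) $$ (i, j) \<preceq> per_adj A $$ (i, j)" by simp
  qed
qed (use A in \<open>auto simp: per_adj_def\<close>)

text \<open>
  The adjoint inherits the hypotheses of \<open>per_dominant_diagonal\<close>: its diagonal entries are permanents
  of principal submatrices, which again have the dominant diagonal \<open>d\<close>, and every entry is a supremum
  of products of \<open>m\<close> entries of \<open>A\<close>.
\<close>
lemma per_adj_diagonal_dominant:
  fixes A :: "'a :: add_idem_comm_semiring_1 mat"
  assumes A: "A \<in> carrier_mat (Suc m) (Suc m)"
    and diag: "\<And>i. i < Suc m \<Longrightarrow> A $$ (i, i) = d"
    and dom: "\<And>i j. i < Suc m \<Longrightarrow> j < Suc m \<Longrightarrow> A $$ (i, j) \<preceq> d"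
  shows "i < Suc m \<Longrightarrow> per_adj A $$ (i, i) = d ^ m"
    and "i < Suc m \<Longrightarrow> j < Suc m \<Longrightarrow> per_adj A $$ (i, j) \<preceq> d ^ m"
proof -
  let ?V = "{0..<Suc m}"
  have le: "per_adj A $$ (i, j) \<preceq> d ^ m" if i: "i < Suc m" and j: "j < Suc m" for i j
  proof -
    have "per_adj A $$ (i, j) =
        (\<Sum>p | p permutes ?V \<and> p j = i. \<Prod>k\<in>?V - {j}. A $$ (k, p k))"
      by (rule per_adj_entry[OF A i j])
    also have "\<dots> \<preceq> d ^ m"
    proof (rule sr_sum_le)
      fix p assume "p \<in> {p. p permutes ?V \<and> p j = i}"
      then have "A $$ (k, p k) \<preceq> d" if "k \<in> ?V - {j}" for k
        using that permutes_in_image[of p ?V k] by (intro dom) auto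
      then have "(\<Prod>k\<in>?V - {j}. A $$ (k, p k)) \<preceq> d ^ card (?V - {j})"
        by (rule sr_prod_le_power)
      then show "(\<Prod>k\<in>?V - {j}. A $$ (k, p k)) \<preceq> d ^ m"
        using j by simp
    qed
    finally show ?thesis .
  qed
  show "i < Suc m \<Longrightarrow> j < Suc m \<Longrightarrow> per_adj A $$ (i, j) \<preceq> d ^ m"
    by (rule le)
  show "per_adj A $$ (i, i) = d ^ m" if i: "i < Suc m"
  proof -
    have "mat_delete A i i $$ (k, l) = A $$ (insert_index i k, insert_index i l)"
      if "k < m" "l < m" for k l
      using mat_delete_index[OF A i i that] by simp
    moreover have "insert_index i k < Suc m" if "k < m" for k
      using that by (simp add: insert_index_def)
    ultimately have "per (mat_delete A i i) = d ^ m"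
      using A by (intro per_dominant_diagonal) (auto simp: diag dom)
    then show ?thesis using A i by (simp add: per_adj_def)
  qed
qed

theorem theorem3p3:
  fixes A :: "'a :: add_idem_comm_semiring_1 mat" and n :: nat
  assumes "n \<ge> 2"
    and "A \<in> carrier_mat n n"
    and "\<And>i j k. i < n \<Longrightarrow> j < n \<Longrightarrow> k < n \<Longrightarrow> A $$ (j, k) \<preceq> A $$ (i, i)"
  shows "per_adj A = A ^\<^sub>m (n - 1) \<and>
         per (per_adj A) = per A ^ (n - 1)"
proof -
  obtain m where n: "n = Suc m" using assms(1) by (cases n) auto
  define d where "d = A $$ (0, 0)"
  have diag: "A $$ (i, i) = d" if "i < Suc m" for i
    unfolding d_def by (rule sr_le_antisym) (use that n assms(3) in auto)
  have dom: "A $$ (i, j) \<preceq> d" if "i < Suc m" "j < Suc m" for i j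
    unfolding d_def by (rule assms(3)) (use that n in auto)
  have A: "A \<in> carrier_mat (Suc m) (Suc m)" using assms(2) n by simp
  have "per (per_adj A) = (d ^ m) ^ Suc m"
    using A by (intro per_dominant_diagonal per_adj_diagonal_dominant[OF A diag dom])
               (auto simp: per_adj_def)
  also have "\<dots> = (d ^ Suc m) ^ m"
    by (simp only: power_mult[symmetric] mult.commute)
  also have "d ^ Suc m = per A"
    by (rule per_dominant_diagonal[OF A diag dom, symmetric])
  finally show ?thesis
    using per_adj_eq_pow_mat[OF A diag dom] n by simp
qed

end
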